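(* For every finite field $\mathbb{F}$ with $|\mathbb{F}|\ge 5$ there exists a superregular $3\times3$ matrix $G$ over $\mathbb{F}$ which has both a forward and a backward decomposition, i.e. there exist $2\times 2$ matrices $A,B,C$ and $A',B',C'$ over $\mathbb{F}$ with $$G=\tilde C\tilde B\tilde A\qquad\text{and}\qquad G=\tilde A'\tilde B'\tilde C'.$$
   Context: A matrix over a field is superregular if all of its minors (of all sizes, including the entries and the full determinant) are nonzero. For $2\times 2$ matrices $A=[a_{ij}]$, $B=[b_{ij}]$, $C=[c_{ij}]$ over $\mathbb{F}$, define $$\tilde A=\begin{bmatrix} a_{11} & a_{12} & 0 \\ a_{21} & a_{22} & 0 \\ 0 & 0 & 1 \end{bmatrix},\quad \tilde B=\begin{bmatrix} b_{11} & 0 & b_{12} \\ 0 & 1 & 0 \\ b_{21} & 0 & b_{22} \end{bmatrix},\quad \tilde C=\begin{bmatrix} 1 & 0 & 0 \\ 0 & c_{11} & c_{12} \\ 0 & c_{21} & c_{22} \end{bmatrix},$$ and $\tilde A',\tilde B',\tilde C'$ are defined from $A',B',C'$ in the same way (same positions). *)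

theory Defs
  imports
    "Jordan_Normal_Form.Determinant"
    "Jordan_Normal_Form.DL_Submatrix"
    "HOL-Library.Cardinality"
begin

text \<open>Matrix indices are 0-based: the entry $a_{11}$ of the mathematics is \<open>A $$ (0,0)\<close>.\<close>

definition superregular :: "'a::field mat \<Rightarrow> bool" where
  "superregular A \<longleftrightarrow>
     (\<forall>I J. I \<subseteq> {..<dim_row A} \<longrightarrow> J \<subseteq> {..<dim_col A} \<longrightarrow> I \<noteq> {} \<longrightarrow> card I = card J \<longrightarrow>
        det (submatrix A I J) \<noteq> 0)"

definition tildeA :: "'a::field mat \<Rightarrow> 'a mat" where
  "tildeA A = mat_of_rows_list 3
     [[A $$ (0,0), A $$ (0,1), 0],
      [A $$ (1,0), A $$ (1,1), 0],
      [0,          0,          1]]"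

definition tildeB :: "'a::field mat \<Rightarrow> 'a mat" where
  "tildeB B = mat_of_rows_list 3
     [[B $$ (0,0), 0, B $$ (0,1)],
      [0,          1, 0         ],
      [B $$ (1,0), 0, B $$ (1,1)]]"

definition tildeC :: "'a::field mat \<Rightarrow> 'a mat" where
  "tildeC C = mat_of_rows_list 3
     [[1, 0,          0         ],
      [0, C $$ (0,0), C $$ (0,1)],
      [0, C $$ (1,0), C $$ (1,1)]]"

definition has_forward_decomposition :: "'a::field mat \<Rightarrow> bool" where
  "has_forward_decomposition G \<longleftrightarrow>
     (\<exists>A \<in> carrier_mat 2 2. \<exists>B \<in> carrier_mat 2 2. \<exists>C \<in> carrier_mat 2 2.
        G = tildeC C * tildeB B * tildeA A)"

definition has_backward_decomposition :: "'a::field mat \<Rightarrow> bool" where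
  "has_backward_decomposition G \<longleftrightarrow>
     (\<exists>A \<in> carrier_mat 2 2. \<exists>B \<in> carrier_mat 2 2. \<exists>C \<in> carrier_mat 2 2.
        G = tildeA A * tildeB B * tildeC C)"

end

(* For symmetric G the two decompositions are transposes of each other, so it suffices to find a
   forward one.  After normalising the first row and column to ones,
   G = [[1, 1, 1], [1, x, y], [1, y, w]] has a forward decomposition as soon as
   det [[1, 1, 0], [1, x, y], [1, y, w]] = x w - y^2 - w + y is nonzero: the inverse of C only has to
   combine rows 2 and 3 of G into one row with last entry 0 and one row whose first two entries
   agree.  Parameters meeting this and superregularity are (x, y, w) = (2, 3, 4) outside
   characteristic 2 and 3; in those characteristics w = x works with y and then x chosen to avoid
   at most four values. *)

theory Submission
  imports Defs
begin

lemma transpose_tildeA: "A \<in> carrier_mat 2 2 \<Longrightarrow> tildeA (transpose_mat A) = transpose_mat (tildeA A)"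
  by (rule eq_matI) (auto simp: tildeA_def mat_of_rows_list_def numeral_3_eq_3 less_Suc_eq)

lemma transpose_tildeB: "B \<in> carrier_mat 2 2 \<Longrightarrow> tildeB (transpose_mat B) = transpose_mat (tildeB B)"
  by (rule eq_matI) (auto simp: tildeB_def mat_of_rows_list_def numeral_3_eq_3 less_Suc_eq)

lemma transpose_tildeC: "C \<in> carrier_mat 2 2 \<Longrightarrow> tildeC (transpose_mat C) = transpose_mat (tildeC C)"
  by (rule eq_matI) (auto simp: tildeC_def mat_of_rows_list_def numeral_3_eq_3 less_Suc_eq)

lemma tilde_carrier [simp]:
  "tildeA A \<in> carrier_mat 3 3" "tildeB A \<in> carrier_mat 3 3" "tildeC A \<in> carrier_mat 3 3"
  by (auto simp: tildeA_def tildeB_def tildeC_def mat_of_rows_list_def)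

text \<open>Transposing reverses the order of the factors, and the zero pattern of each tilde matrix
  is symmetric, so the transposed 2x2 blocks serve as the backward factors.\<close>

lemma has_backward_decomposition_transpose:
  assumes "has_forward_decomposition G"
  shows "has_backward_decomposition (transpose_mat G)"
proof -
  obtain A B C where carr: "A \<in> carrier_mat 2 2" "B \<in> carrier_mat 2 2" "C \<in> carrier_mat 2 2"
    and G: "G = tildeC C * tildeB B * tildeA A"
    using assms unfolding has_forward_decomposition_def by blast
  have "transpose_mat G = transpose_mat (tildeA A) * (transpose_mat (tildeB B) * transpose_mat (tildeC C))"
    unfolding G
    by (simp add: transpose_mult [OF mult_carrier_mat [OF tilde_carrier(3,2)] tilde_carrier(1)]
        transpose_mult [OF tilde_carrier(3,2)])
  also have "\<dots> = transpose_mat (tildeA A) * transpose_mat (tildeB B) * transpose_mat (tildeC C)"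
    by (rule assoc_mult_mat [symmetric, of _ 3 3 _ 3 _ 3]) simp_all
  finally have "transpose_mat G =
      tildeA (transpose_mat A) * tildeB (transpose_mat B) * tildeC (transpose_mat C)"
    by (simp add: carr transpose_tildeA transpose_tildeB transpose_tildeC)
  then show ?thesis
    unfolding has_backward_decomposition_def using carr by (meson transpose_carrier_mat)
qed

definition bordered_sym_mat :: "'a::field \<Rightarrow> 'a \<Rightarrow> 'a \<Rightarrow> 'a mat" where
  "bordered_sym_mat x y w = mat_of_rows_list 3 [[1, 1, 1], [1, x, y], [1, y, w]]"

lemma bordered_sym_mat_carrier: "bordered_sym_mat x y w \<in> carrier_mat 3 3"
  by (auto simp: bordered_sym_mat_def mat_of_rows_list_def)

lemma transpose_bordered_sym_mat: "transpose_mat (bordered_sym_mat x y w) = bordered_sym_mat x y w"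
  by (rule eq_matI) (auto simp: bordered_sym_mat_def mat_of_rows_list_def numeral_3_eq_3 less_Suc_eq)

lemma forward_decomposition_bordered_sym_mat:
  fixes x y w :: "'a::field"
  assumes "x * w - y\<^sup>2 - w + y \<noteq> 0"
  shows "has_forward_decomposition (bordered_sym_mat x y w)"
proof -
  define D where "D = x * w - y\<^sup>2 - w + y"
  \<comment> \<open>\<open>C\<close> is the inverse of \<open>[[w, -y], [y - 1, 1 - x]]\<close>, of
    determinant \<open>- D\<close>. Applied to rows 2 and 3 of the target, that matrix yields
    \<open>[w - y, x * w - y\<^sup>2, 0]\<close> and \<open>[y - x, y - x, - D]\<close>, from which
    the second rows of \<open>A\<close> and \<open>B\<close> are read off.\<close>
  define A where "A = mat_of_rows_list 2 [[1, 1], [w - y, x * w - y\<^sup>2]]"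
  define B where "B = mat_of_rows_list 2 [[1, 1], [y - x, - D]]"
  define C where "C = mat_of_rows_list 2 [[(x - 1) / D, - y / D], [(y - 1) / D, - w / D]]"
  have "D \<noteq> 0" using assms by (simp add: D_def)
  have carr: "A \<in> carrier_mat 2 2" "B \<in> carrier_mat 2 2" "C \<in> carrier_mat 2 2"
    by (auto simp: A_def B_def C_def mat_of_rows_list_def)
  have "bordered_sym_mat x y w = tildeC C * tildeB B * tildeA A"
    \<comment> \<open>Denominators are cleared while \<open>D\<close> is an opaque nonzero element;
      expanding it then leaves polynomial identities.\<close>
    using \<open>D \<noteq> 0\<close>
    by (intro eq_matI; auto simp: bordered_sym_mat_def tildeA_def tildeB_def tildeC_def A_def
        B_def C_def mat_of_rows_list_def numeral_3_eq_3 less_Suc_eq scalar_prod_def field_simps;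
        simp add: D_def power2_eq_square algebra_simps)
  then show ?thesis
    unfolding has_forward_decomposition_def using carr by blast
qed

lemma det_2:
  assumes "A \<in> carrier_mat 2 2"
  shows "det A = A $$ (0, 0) * A $$ (1, 1) - A $$ (0, 1) * A $$ (1, 0)"
proof -
  have "det A = (\<Sum>j<2. A $$ (0, j) * cofactor A 0 j)"
    by (rule laplace_expansion_row [OF assms]) simp
  moreover have "mat_delete A 0 j \<in> carrier_mat 1 1" for j
    using mat_delete_carrier [OF assms] by simp
  ultimately show ?thesis
    using assms
    by (simp add: cofactor_def det_single numeral_2_eq_2 lessThan_Suc mat_delete_def)
qed

lemma det_3:
  assumes "A \<in> carrier_mat 3 3"
  shows "det A = A $$ (0, 0) * (A $$ (1, 1) * A $$ (2, 2) - A $$ (1, 2) * A $$ (2, 1))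
    - A $$ (0, 1) * (A $$ (1, 0) * A $$ (2, 2) - A $$ (1, 2) * A $$ (2, 0))
    + A $$ (0, 2) * (A $$ (1, 0) * A $$ (2, 1) - A $$ (1, 1) * A $$ (2, 0))"
proof -
  have "det A = (\<Sum>j<3. A $$ (0, j) * cofactor A 0 j)"
    by (rule laplace_expansion_row [OF assms]) simp
  moreover have minor: "mat_delete A 0 j \<in> carrier_mat 2 2" for j
    using mat_delete_carrier [OF assms] by simp
  moreover have "{..<3} = {0, 1, 2 :: nat}" by auto
  ultimately have "det A = A $$ (0, 0) * det (mat_delete A 0 0)
      - A $$ (0, 1) * det (mat_delete A 0 1) + A $$ (0, 2) * det (mat_delete A 0 2)"
    by (simp add: cofactor_def)
  then show ?thesis
    unfolding det_2 [OF minor] using assms by (simp add: mat_delete_def numeral_2_eq_2)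
qed

text \<open>Replaces index sets by explicit indices: a square submatrix has size 1, 2 or 3, giving
  the nine entries, the nine 2x2 minors and the determinant.\<close>

lemma superregular_3I:
  fixes G :: "'a::field mat"
  assumes G: "G \<in> carrier_mat 3 3"
    and entries: "\<And>i j. i < 3 \<Longrightarrow> j < 3 \<Longrightarrow> G $$ (i, j) \<noteq> 0"
    and minors: "\<And>i i' j j'. i < i' \<Longrightarrow> i' < 3 \<Longrightarrow> j < j' \<Longrightarrow> j' < 3 \<Longrightarrow>
      G $$ (i, j) * G $$ (i', j') \<noteq> G $$ (i, j') * G $$ (i', j)"
    and det: "det G \<noteq> 0"
  shows "superregular G"
  unfolding superregular_def
proof (intro allI impI)
  fix I J
  assume "I \<subseteq> {..<dim_row G}" "J \<subseteq> {..<dim_col G}" and "I \<noteq> {}" and card: "card I = card J"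
  then have I: "I \<subseteq> {..<3}" and J: "J \<subseteq> {..<3}" using G by auto
  then have fin: "finite I" "finite J" by (auto intro: finite_subset)
  have rows: "{i. i < dim_row G \<and> i \<in> I} = I" and cols: "{j. j < dim_col G \<and> j \<in> J} = J"
    using I J G by auto
  let ?S = "submatrix G I J"
  have dim: "?S \<in> carrier_mat (card I) (card I)"
    using dim_submatrix [of G I J] rows cols card by auto
  have entry: "?S $$ (i, j) = G $$ (pick I i, pick J j)" if "i < card I" "j < card I" for i j
    using submatrix_index [of i G I j J] that rows cols card by auto
  have pick: "pick I i < 3" "pick J i < 3" if "i < card I" for i
    using pick_in_set [of i I] pick_in_set [of i J] that I J card by auto
  \<comment> \<open>\<open>pick\<close> enumerates a set in increasing order, which is the ordering
    that \<open>minors\<close> demands.\<close>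
  have pick_mono: "pick I 0 < pick I 1" "pick J 0 < pick J 1" if "1 < card I"
    using pick_mono [of 1 I 0] pick_mono [of 1 J 0] that card by auto
  have "card I \<le> 3" using card_mono [OF _ I] by simp
  moreover have "card I \<noteq> 0" using \<open>I \<noteq> {}\<close> fin by simp
  ultimately consider "card I = 1" | "card I = 2" | "card I = 3" by linarith
  then show "det ?S \<noteq> 0"
  proof cases
    case 1
    then show ?thesis using dim entry [of 0 0] pick [of 0] entries by (simp add: det_single)
  next
    case 2
    then have "?S \<in> carrier_mat 2 2" using dim by simp
    then show ?thesis
      using 2 entry pick minors [of "pick I 0" "pick I 1" "pick J 0" "pick J 1"] pick_mono
      by (simp add: det_2 del: One_nat_def pick.simps)
  next
    case 3
    then have "I = {..<3}" "J = {..<3}"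
      using card card_subset_eq [OF _ I] card_subset_eq [OF _ J] by auto
    \<comment> \<open>The index i has exactly i predecessors in the full index set, so selecting all
      rows and columns changes nothing.\<close>
    moreover have "pick {..<3} i = i" if "i < 3" for i :: nat
    proof -
      have "{a \<in> {..<3}. a < i} = {..<i}" using that by auto
      then show ?thesis using pick_card_in_set [of i "{..<3}"] that by simp
    qed
    ultimately have "?S = G"
      using G dim entry 3 by (intro eq_matI) auto
    then show ?thesis using det by simp
  qed
qed

lemma det_bordered_sym_mat:
  "det (bordered_sym_mat x y w) = (x - 1) * (w - 1) - (y - 1)\<^sup>2"
  by (subst det_3 [OF bordered_sym_mat_carrier])
    (simp add: bordered_sym_mat_def mat_of_rows_list_def power2_eq_square algebra_simps)

text \<open>Because of the border of ones, the 2x2 minors are, up to sign, \<open>x - 1\<close>,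
  \<open>y - 1\<close>, \<open>w - 1\<close>, \<open>x - y\<close>, \<open>w - y\<close> and
  \<open>x * w - y\<^sup>2\<close>.\<close>

lemma superregular_bordered_sym_mat:
  fixes x y w :: "'a::field"
  assumes "x \<notin> {0, 1}" "y \<notin> {0, 1}" "w \<notin> {0, 1}" "x \<noteq> y" "w \<noteq> y"
    and "x * w \<noteq> y\<^sup>2" "(x - 1) * (w - 1) \<noteq> (y - 1)\<^sup>2"
  shows "superregular (bordered_sym_mat x y w)"
proof (rule superregular_3I [OF bordered_sym_mat_carrier])
  show "det (bordered_sym_mat x y w) \<noteq> 0" using assms by (simp add: det_bordered_sym_mat)
qed (use assms in \<open>auto simp: bordered_sym_mat_def mat_of_rows_list_def numeral_3_eq_3 less_Suc_eq
  power2_eq_square\<close>)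

lemma ex_notin_if_card_less:
  fixes xs :: "'a::finite list"
  assumes "length xs < CARD('a)"
  shows "\<exists>x. x \<notin> set xs"
  using assms card_length [of xs] by (metis leD subsetI top.extremum_uniqueI)

lemma ex_superregular_parameters:
  assumes "CARD('a::{field,finite}) \<ge> 5"
  shows "\<exists>x y w :: 'a. x \<notin> {0, 1} \<and> y \<notin> {0, 1} \<and> w \<notin> {0, 1} \<and> x \<noteq> y \<and> w \<noteq> y \<and>
    x * w \<noteq> y\<^sup>2 \<and> (x - 1) * (w - 1) \<noteq> (y - 1)\<^sup>2 \<and> x * w - y\<^sup>2 - w + y \<noteq> 0"
proof -
  \<comment> \<open>With \<open>w = x\<close> all three quadratic conditions share the factor
    \<open>x - y\<close>; the cofactors require \<open>x + y\<close> to avoid 0, 2 and 1.\<close>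
  have diag: ?thesis
    if "x \<notin> {0, 1}" "y \<notin> {0, 1}" "x \<noteq> y" "x + y \<noteq> 0" "x + y \<noteq> 1" "x + y \<noteq> 2" for x y :: 'a
  proof (intro exI conjI)
    have "x * x - y\<^sup>2 = (x - y) * (x + y)"
      "(x - 1) * (x - 1) - (y - 1)\<^sup>2 = (x - y) * (x + y - 2)"
      "x * x - y\<^sup>2 - x + y = (x - y) * (x + y - 1)"
      by (simp_all add: power2_eq_square algebra_simps)
    then show "x * x \<noteq> y\<^sup>2" "(x - 1) * (x - 1) \<noteq> (y - 1)\<^sup>2" "x * x - y\<^sup>2 - x + y \<noteq> 0"
      using that by auto
  qed (use that in auto)
  consider "(2::'a) = 0" | "(3::'a) = 0" | "(2::'a) \<noteq> 0" "(3::'a) \<noteq> 0" by blast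
  then show ?thesis
  proof cases
    case 1
    then have neg: "- a = a" for a :: 'a
      by (metis mult_2 mult_zero_left neg_eq_iff_add_eq_0)
    obtain y :: 'a where y: "y \<notin> set [0, 1]"
      using ex_notin_if_card_less [of "[0, 1 :: 'a]"] assms by auto
    \<comment> \<open>In characteristic 2 the sum \<open>x + y\<close> is 0 or 1 only for
      \<open>x = y\<close> or \<open>x = 1 + y\<close>, and 2 is 0. Avoiding four values is where
      five field elements are used.\<close>
    obtain x :: 'a where x: "x \<notin> set [0, 1, y, 1 + y]"
      using ex_notin_if_card_less [of "[0, 1, y, 1 + y]"] assms by auto
    show ?thesis
    proof (rule diag)
      show "x + y \<noteq> 0" "x + y \<noteq> 1" "x + y \<noteq> 2"
        using x 1 neg [of y] by (auto simp: add_eq_0_iff2 eq_diff_eq [symmetric])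
    qed (use x y in auto)
  next
    case 2
    then have two: "(2::'a) = - 1"
      by (simp add: eq_neg_iff_add_eq_0)
    have "(2::'a) \<noteq> 0" unfolding two by simp
    \<comment> \<open>With \<open>y = - 1\<close> in characteristic 3, the sum \<open>x - 1\<close>
      is 0, 1 or 2 exactly when \<open>x\<close> is 1, -1 or 0.\<close>
    obtain x :: 'a where x: "x \<notin> set [0, 1, - 1]"
      using ex_notin_if_card_less [of "[0, 1, - 1 :: 'a]"] assms by auto
    show ?thesis
    proof (rule diag [of x "- 1"])
      show "x + - 1 \<noteq> 1" "x + - 1 \<noteq> 2" "- 1 \<notin> {0, 1 :: 'a}"
        using x two \<open>(2::'a) \<noteq> 0\<close> 2 by (auto simp: algebra_simps)
    qed (use x in auto)
  next
    case 3
    have "(4::'a) \<noteq> 0" using 3 by (metis mult_eq_0_iff mult_2 numeral_Bit0)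
    \<comment> \<open>The differences of the two sides are 3, 2, 1, 1, -1, then -1, -1 and -2 for
      the quadratic conditions, so only 2 and 3 must be nonzero.\<close>
    have "(4::'a) \<noteq> 1" "(3::'a) \<noteq> 1" "(2::'a) \<noteq> 1" "(4::'a) \<noteq> 3" "(2::'a) \<noteq> 3"
      "(2::'a) * 4 \<noteq> 3\<^sup>2" "((2::'a) - 1) * (4 - 1) \<noteq> (3 - 1)\<^sup>2"
      "(2::'a) * 4 - 3\<^sup>2 - 4 + 3 \<noteq> 0"
      using 3 by (subst right_minus_eq [symmetric], simp)+
    with 3 \<open>4 \<noteq> 0\<close> show ?thesis
      by - (rule exI [of _ 2], rule exI [of _ 3], rule exI [of _ 4], blast)
  qed
qed

theorem mainTheorem4:
  assumes "CARD('a::{field,finite}) \<ge> 5"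
  shows "\<exists>G :: 'a mat. G \<in> carrier_mat 3 3 \<and> superregular G \<and>
           has_forward_decomposition G \<and> has_backward_decomposition G"
proof -
  obtain x y w :: 'a
    where xyw: "x \<notin> {0, 1}" "y \<notin> {0, 1}" "w \<notin> {0, 1}" "x \<noteq> y" "w \<noteq> y"
      "x * w \<noteq> y\<^sup>2" "(x - 1) * (w - 1) \<noteq> (y - 1)\<^sup>2" "x * w - y\<^sup>2 - w + y \<noteq> 0"
    using ex_superregular_parameters [OF assms] by blast
  have "has_forward_decomposition (bordered_sym_mat x y w)"
    by (rule forward_decomposition_bordered_sym_mat) fact
  moreover from this have "has_backward_decomposition (bordered_sym_mat x y w)"
    using has_backward_decomposition_transpose transpose_bordered_sym_mat by metis
  moreover have "superregular (bordered_sym_mat x y w)"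
    using superregular_bordered_sym_mat xyw by blast
  ultimately show ?thesis
    using bordered_sym_mat_carrier by blast
qed

end
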